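(* Let $\mathbf{B}\in\mathbb{IR}^{n\times k}$ and $\mathbf{C}\in\mathbb{IR}^{n\times(n-k)}$ with $C_\Delta>0$ (every entry of $\mathbf{C}$ has positive radius). Consider the quantified interval matrix $(\mathbf{B}^{\forall}\;\mathbf{C}^{\exists})$ in which all entries of $\mathbf{B}$ are universally quantified and all entries of $\mathbf{C}$ are existentially quantified. Then $(\mathbf{B}^{\forall}\;\mathbf{C}^{\exists})$ is AE regular if and only if $\mathbf{B}^{\forall}$ has strongly full column rank.
   Context: An interval matrix is a set $\mathbf{A}=\{A\in\mathbb{R}^{m\times n} : \underline{A}\le A\le\overline{A}\}$, where $\underline{A}\le\overline{A}$ are given real matrices and inequalities are entrywise; $\mathbb{IR}^{m\times n}$ is the set of all $m\times n$ interval matrices. The radius matrix of $\mathbf{A}$ is $A_\Delta=\frac12(\overline{A}-\underline{A})$. A quantified interval matrix has each interval entry associated with either the universal or the existential quantifier. It is AE regular if for every choice of values of the universally quantified entries from their intervals there is a choice of values of the existentially quantified entries from their intervals such that the resulting real matrix is nonsingular; here: for every $B\in\mathbf{B}$ there is $C\in\mathbf{C}$ such that $(B\;C)$ is nonsingular. An interval matrix $\mathbf{M}$ has strongly full column rank if every real matrix $M\in\mathbf{M}$ has full column rank (linearly independent columns). *)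

theory Defs
  imports "Jordan_Normal_Form.DL_Rank"
begin

datatype imat = IMat (lower_mat: "real mat") (upper_mat: "real mat")

definition IR_mat :: "nat \<Rightarrow> nat \<Rightarrow> imat set" where
  "IR_mat m n = {A. lower_mat A \<in> carrier_mat m n \<and> upper_mat A \<in> carrier_mat m n
                  \<and> lower_mat A \<le> upper_mat A}"

text \<open>The order on \<^typ>\<open>real mat\<close> is entrywise and includes equality of the dimensions.\<close>

definition members :: "imat \<Rightarrow> real mat set" where
  "members A = {M. lower_mat A \<le> M \<and> M \<le> upper_mat A}"

definition radius_mat :: "imat \<Rightarrow> real mat" where
  "radius_mat A = (1/2) \<cdot>\<^sub>m (upper_mat A - lower_mat A)"

definition append_cols :: "'a mat \<Rightarrow> 'a mat \<Rightarrow> 'a mat" where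
  "append_cols A B = mat (dim_row A) (dim_col A + dim_col B)
     (\<lambda>(i, j). if j < dim_col A then A $$ (i, j) else B $$ (i, j - dim_col A))"

datatype quantifier = Forall | Exists

datatype qimat = QIMat (interval_part: imat) (quantifiers: "quantifier mat")

definition quantify :: "quantifier \<Rightarrow> imat \<Rightarrow> qimat" where
  "quantify q A = QIMat A (mat (dim_row (lower_mat A)) (dim_col (lower_mat A)) (\<lambda>_. q))"

definition append_cols_q :: "qimat \<Rightarrow> qimat \<Rightarrow> qimat" where
  "append_cols_q P Q = QIMat
     (IMat (append_cols (lower_mat (interval_part P)) (lower_mat (interval_part Q)))
           (append_cols (upper_mat (interval_part P)) (upper_mat (interval_part Q))))
     (append_cols (quantifiers P) (quantifiers Q))"

text \<open>A choice of values for the universally quantified entries is given by a member \<open>F\<close> of the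
  interval matrix, of which only the universally quantified entries matter. The matrix \<open>M\<close> retains
  these and is free, within the intervals, in the existentially quantified ones.\<close>

definition AE_regular :: "qimat \<Rightarrow> bool" where
  "AE_regular Q \<longleftrightarrow> (\<forall>F \<in> members (interval_part Q). \<exists>M \<in> members (interval_part Q).
     (\<forall>i < dim_row M. \<forall>j < dim_col M. quantifiers Q $$ (i, j) = Forall \<longrightarrow> M $$ (i, j) = F $$ (i, j))
     \<and> invertible_mat M)"

definition full_column_rank :: "real mat \<Rightarrow> bool" where
  "full_column_rank M \<longleftrightarrow> vec_space.rank (dim_row M) M = dim_col M"

definition strongly_full_column_rank :: "imat \<Rightarrow> bool" where
  "strongly_full_column_rank A \<longleftrightarrow> (\<forall>M \<in> members A. full_column_rank M)"

lemma full_column_rank_iff_lin_indpt: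
  "full_column_rank M \<longleftrightarrow>
     distinct (cols M) \<and> module.lin_indpt class_ring (module_vec TYPE(real) (dim_row M)) (set (cols M))"
proof -
  interpret vec_space "TYPE(real)" "dim_row M" .
  have M: "M \<in> carrier_mat (dim_row M) (dim_col M)" by simp
  have dist: "distinct (cols M)" if r: "rank M = dim_col M"
  proof -
    obtain S where S: "maximal S (\<lambda>T. T \<subseteq> set (cols M) \<and> lin_indpt T)"
      using maximal_exists[of "(\<lambda>T. T \<subseteq> set (cols M) \<and> lin_indpt T)" "card (set (cols M))" "{}"]
      by (meson List.finite_set card_mono empty_iff empty_subsetI finite_lin_indpt2 rev_finite_subset)
    have "S \<subseteq> set (cols M)" using S unfolding maximal_def by blast
    then have "card S \<le> card (set (cols M))" by (intro card_mono) auto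
    moreover have "rank M = card S" by (rule rank_card_indpt[OF M S])
    moreover have "card (set (cols M)) \<le> length (cols M)" by (rule card_length)
    ultimately have "card (set (cols M)) = length (cols M)" using r by (simp only: cols_length)
    then show ?thesis by (rule card_distinct)
  qed
  show ?thesis
    unfolding full_column_rank_def
  proof
    assume r: "rank M = dim_col M"
    show "distinct (cols M) \<and> lin_indpt (set (cols M))"
      using dist[OF r] full_rank_lin_indpt[OF M r dist[OF r]] by (rule conjI)
  next
    assume "distinct (cols M) \<and> lin_indpt (set (cols M))"
    then show "rank M = dim_col M" using lin_indpt_full_rank[OF M] by blast
  qed
qed

lemma IR_matD:
  assumes "A \<in> IR_mat m n"
  shows "dim_row (lower_mat A) = m" "dim_col (lower_mat A) = n"
    "dim_row (upper_mat A) = m" "dim_col (upper_mat A) = n"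
    "\<And>i j. i < m \<Longrightarrow> j < n \<Longrightarrow> lower_mat A $$ (i, j) \<le> upper_mat A $$ (i, j)"
  using assms unfolding IR_mat_def less_eq_mat_def carrier_mat_def mem_Collect_eq by simp_all

lemma members_iff:
  assumes "A \<in> IR_mat m n"
  shows "M \<in> members A \<longleftrightarrow> dim_row M = m \<and> dim_col M = n \<and>
    (\<forall>i < m. \<forall>j < n. lower_mat A $$ (i, j) \<le> M $$ (i, j) \<and> M $$ (i, j) \<le> upper_mat A $$ (i, j))"
proof
  assume "M \<in> members A"
  then have 1: "lower_mat A \<le> M" and 2: "M \<le> upper_mat A"
    unfolding members_def by blast+
  have d: "dim_row M = m" "dim_col M = n"
    using 1 unfolding less_eq_mat_def IR_matD(1,2)[OF assms] by simp_all
  show "dim_row M = m \<and> dim_col M = n \<and>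
    (\<forall>i < m. \<forall>j < n. lower_mat A $$ (i, j) \<le> M $$ (i, j) \<and> M $$ (i, j) \<le> upper_mat A $$ (i, j))"
    using 1 2 unfolding less_eq_mat_def IR_matD(1-4)[OF assms] d by blast
next
  assume "dim_row M = m \<and> dim_col M = n \<and>
    (\<forall>i < m. \<forall>j < n. lower_mat A $$ (i, j) \<le> M $$ (i, j) \<and> M $$ (i, j) \<le> upper_mat A $$ (i, j))"
  then show "M \<in> members A"
    by (simp add: members_def less_eq_mat_def IR_matD(1-4)[OF assms])
qed

lemma dim_append_cols [simp]:
  "dim_row (append_cols A B) = dim_row A"
  "dim_col (append_cols A B) = dim_col A + dim_col B"
  by (simp_all add: append_cols_def)

lemma index_append_cols:
  "i < dim_row A \<Longrightarrow> j < dim_col A + dim_col B \<Longrightarrow>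
    append_cols A B $$ (i, j) = (if j < dim_col A then A $$ (i, j) else B $$ (i, j - dim_col A))"
  by (simp add: append_cols_def)

lemma IR_mat_append_cols:
  assumes B: "B \<in> IR_mat n k" and C: "C \<in> IR_mat n l"
  shows "IMat (append_cols (lower_mat B) (lower_mat C)) (append_cols (upper_mat B) (upper_mat C))
          \<in> IR_mat n (k + l)"
proof -
  let ?L = "append_cols (lower_mat B) (lower_mat C)"
  let ?U = "append_cols (upper_mat B) (upper_mat C)"
  have LU: "?L \<in> carrier_mat n (k + l)" "?U \<in> carrier_mat n (k + l)"
    unfolding carrier_mat_def by (simp_all add: IR_matD(1-4)[OF B] IR_matD(1-4)[OF C])
  have "?L $$ (i, j) \<le> ?U $$ (i, j)" if ij: "i < n" "j < k + l" for i j
  proof (cases "j < k")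
    case True
    then show ?thesis
      using IR_matD(5)[OF B ij(1) True] ij
      by (simp add: index_append_cols IR_matD(1-4)[OF B] IR_matD(1-4)[OF C])
  next
    case False
    then have "j - k < l" using ij(2) by linarith
    from IR_matD(5)[OF C ij(1) this] show ?thesis
      using False ij
      by (simp add: index_append_cols IR_matD(1-4)[OF B] IR_matD(1-4)[OF C])
  qed
  then have "?L \<le> ?U"
    unfolding less_eq_mat_def dim_append_cols IR_matD(1-4)[OF B] IR_matD(1-4)[OF C] by blast
  then show ?thesis
    using LU unfolding IR_mat_def imat.sel mem_Collect_eq by blast
qed

lemma members_append_cols:
  assumes B: "B \<in> IR_mat n k" and C: "C \<in> IR_mat n l"
    and X: "X \<in> members B" and Y: "Y \<in> members C"
  shows "append_cols X Y \<in> members (IMat (append_cols (lower_mat B) (lower_mat C))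
                                          (append_cols (upper_mat B) (upper_mat C)))"
  using X Y unfolding members_iff[OF B] members_iff[OF C] members_iff[OF IR_mat_append_cols[OF B C]]
  by (simp add: index_append_cols IR_matD(1-4)[OF B] IR_matD(1-4)[OF C])

lemma members_append_cols_split:
  assumes B: "B \<in> IR_mat n k" and C: "C \<in> IR_mat n l"
    and M: "M \<in> members (IMat (append_cols (lower_mat B) (lower_mat C))
                               (append_cols (upper_mat B) (upper_mat C)))"
  obtains X Y where "X \<in> members B" "Y \<in> members C" "M = append_cols X Y"
proof
  have dM: "dim_row M = n" "dim_col M = k + l"
    using M unfolding members_iff[OF IR_mat_append_cols[OF B C]] by blast+
  have bd: "append_cols (lower_mat B) (lower_mat C) $$ (i, j) \<le> M $$ (i, j)"
       "M $$ (i, j) \<le> append_cols (upper_mat B) (upper_mat C) $$ (i, j)"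
    if "i < n" "j < k + l" for i j
    using M that unfolding members_iff[OF IR_mat_append_cols[OF B C]] imat.sel by blast+
  let ?X = "mat n k (\<lambda>(i, j). M $$ (i, j))"
  let ?Y = "mat n l (\<lambda>(i, j). M $$ (i, k + j))"
  have "lower_mat B $$ (i, j) \<le> M $$ (i, j) \<and> M $$ (i, j) \<le> upper_mat B $$ (i, j)"
    if "i < n" "j < k" for i j
    using bd[of i j] that
    by (simp add: index_append_cols IR_matD(1-4)[OF B] IR_matD(1-4)[OF C])
  then show "?X \<in> members B"
    unfolding members_iff[OF B] by simp
  have "lower_mat C $$ (i, j) \<le> M $$ (i, k + j) \<and> M $$ (i, k + j) \<le> upper_mat C $$ (i, j)"
    if "i < n" "j < l" for i j
    using bd[of i "k + j"] that
    by (simp add: index_append_cols IR_matD(1-4)[OF B] IR_matD(1-4)[OF C])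
  then show "?Y \<in> members C"
    unfolding members_iff[OF C] by simp
  show "M = append_cols ?X ?Y"
    by (intro eq_matI) (simp_all add: dM index_append_cols)
qed

lemma AE_regular_append_iff:
  assumes B: "B \<in> IR_mat n k" and C: "C \<in> IR_mat n l"
  shows "AE_regular (append_cols_q (quantify Forall B) (quantify Exists C)) \<longleftrightarrow>
    (\<forall>X \<in> members B. \<exists>Y \<in> members C. invertible_mat (append_cols X Y))"
    (is "AE_regular ?Q \<longleftrightarrow> ?R")
proof -
  let ?I = "interval_part ?Q"
  have I: "?I = IMat (append_cols (lower_mat B) (lower_mat C)) (append_cols (upper_mat B) (upper_mat C))"
    by (simp add: append_cols_q_def quantify_def)
  have q: "quantifiers ?Q $$ (i, j) = (if j < k then Forall else Exists)"
    if "i < n" "j < k + l" for i j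
    using that by (simp add: append_cols_q_def quantify_def index_append_cols
        IR_matD(1-4)[OF B] IR_matD(1-4)[OF C])
  show ?thesis
  proof
    assume AE: "AE_regular ?Q"
    show ?R
    proof
      fix X assume X: "X \<in> members B"
      have "lower_mat C \<in> members C" 
        unfolding members_iff[OF C] by (simp add: IR_matD[OF C])
      from members_append_cols[OF B C X this]
      obtain M where M: "M \<in> members ?I" "invertible_mat M" and
        e: "\<forall>i < dim_row M. \<forall>j < dim_col M. quantifiers ?Q $$ (i, j) = Forall \<longrightarrow>
              M $$ (i, j) = append_cols X (lower_mat C) $$ (i, j)"
        using AE unfolding AE_regular_def I by blast
      obtain X' Y where XY: "X' \<in> members B" "Y \<in> members C" "M = append_cols X' Y"
        using members_append_cols_split[OF B C M(1)[unfolded I]] by blast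
      have d: "dim_row X = n" "dim_col X = k" "dim_row X' = n" "dim_col X' = k" "dim_col Y = l"
        using X XY(1,2) unfolding members_iff[OF B] members_iff[OF C] by blast+
      have "X' = X"
      proof (intro eq_matI)
        fix i j assume ij: "i < dim_row X" "j < dim_col X"
        then have "M $$ (i, j) = append_cols X (lower_mat C) $$ (i, j)"
          using e q[of i j] by (simp add: d XY(3))
        then show "X' $$ (i, j) = X $$ (i, j)"
          using ij by (simp add: d XY(3) index_append_cols)
      qed (simp_all add: d)
      then show "\<exists>Y \<in> members C. invertible_mat (append_cols X Y)"
        using M XY by blast
    qed
  next
    assume R: ?R
    show "AE_regular ?Q"
      unfolding AE_regular_def
    proof
      fix F assume "F \<in> members ?I"
      then obtain X Z where F: "X \<in> members B" "Z \<in> members C" "F = append_cols X Z"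
        using members_append_cols_split[OF B C] unfolding I by blast
      then obtain Y where Y: "Y \<in> members C" "invertible_mat (append_cols X Y)"
        using R by blast
      have d: "dim_row X = n" "dim_col X = k" "dim_col Y = l" "dim_col Z = l"
        using F(1,2) Y(1) unfolding members_iff[OF B] members_iff[OF C] by blast+
      have "\<forall>i < dim_row (append_cols X Y). \<forall>j < dim_col (append_cols X Y).
              quantifiers ?Q $$ (i, j) = Forall \<longrightarrow> append_cols X Y $$ (i, j) = F $$ (i, j)"
        by (simp add: d F(3) q index_append_cols)
      moreover have "append_cols X Y \<in> members ?I"
        using members_append_cols[OF B C F(1) Y(1)] unfolding I .
      ultimately show "\<exists>M \<in> members ?I. (\<forall>i < dim_row M. \<forall>j < dim_col M.
            quantifiers ?Q $$ (i, j) = Forall \<longrightarrow> M $$ (i, j) = F $$ (i, j)) \<and> invertible_mat M"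
        using Y(2) by blast
    qed
  qed
qed

end

(* If (X Y) is nonsingular, its columns are independent, and so are those of X. Conversely, if X has
   full column rank, suitable columns are chosen from C one at a time: fewer than n vectors span a
   proper subspace, and this cannot contain a box with all side lengths positive, since the
   differences of points of the box include nonzero multiples of all unit vectors. *)
theory Submission
  imports Defs
begin

text \<open>For a square matrix both properties amount to a nonzero determinant.\<close>

lemma invertible_mat_iff_full_column_rank:
  assumes A: "A \<in> carrier_mat n n"
  shows "invertible_mat A \<longleftrightarrow> full_column_rank A"
proof -
  have "invertible_mat A \<longleftrightarrow> det A \<noteq> 0"
  proof
    assume "invertible_mat A"
    then obtain B where B: "A * B = 1\<^sub>m n" "B * A = 1\<^sub>m (dim_row B)"
      using A unfolding invertible_mat_def inverts_mat_def by auto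
    \<comment> \<open>\<open>inverts_mat\<close> does not fix the dimensions of \<open>B\<close>.
      They are read off by comparing the numbers of columns in the two equations.\<close>
    then have "dim_col B = n" "dim_row B = n"
      using A by (metis carrier_matD(2) index_mult_mat(3) index_one_mat(3))+
    then have "B \<in> carrier_mat n n" by auto
    from det_mult[OF A this] have "det A * det B = 1" by (simp add: B(1))
    then show "det A \<noteq> 0" by auto
  next
    assume "det A \<noteq> 0"
    \<comment> \<open>The value \<open>()\<close> only fills the extension slot of the record
      \<open>ring_mat\<close>.\<close>
    from det_non_zero_imp_unit[OF A this, of "()"] A show "invertible_mat A"
      unfolding Units_def ring_mat_def invertible_mat_def inverts_mat_def by auto
  qed
  then show ?thesis
    using vec_space.det_rank_iff[OF A] A by (simp add: full_column_rank_def)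
qed

lemma cols_append_cols:
  assumes "dim_row X = dim_row Y"
  shows "cols (append_cols X Y) = cols X @ cols Y"
proof (rule nth_equalityI)
  fix j assume "j < length (cols (append_cols X Y))"
  then have j: "j < dim_col X + dim_col Y" by simp
  show "cols (append_cols X Y) ! j = (cols X @ cols Y) ! j"
    using j assms by (intro eq_vecI) (auto simp: nth_append index_append_cols)
qed simp

text \<open>Distinctness and linear independence of the columns pass to any part of them.\<close>

lemma full_column_rank_append_colsD:
  assumes "full_column_rank (append_cols X Y)" and "dim_row X = dim_row Y"
  shows "full_column_rank X"
proof -
  interpret vec_space "TYPE(real)" "dim_row X" .
  show ?thesis
    using assms subset_li_is_li[of "set (cols X) \<union> set (cols Y)" "set (cols X)"]
    unfolding full_column_rank_iff_lin_indpt by (simp add: cols_append_cols)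
qed

text \<open>A span that contains all unit vectors is the whole space, and a generating set has at
  least \<open>n\<close> elements.\<close>

lemma (in vec_space) unit_vec_notin_span:
  assumes S: "S \<subseteq> carrier_vec n" and "finite S" and "card S < n"
  shows "\<exists>i<n. unit_vec n i \<notin> span S"
proof (rule ccontr)
  assume "\<not> ?thesis"
  then have "set (unit_vecs n) \<subseteq> span S"
    unfolding unit_vecs_def by auto
  from span_subsetI[OF S this] have "carrier_vec n \<subseteq> span S"
    by (simp only: span_unit_vecs_is_carrier)
  then have "span S = carrier_vec n"
    using span_is_subset2[of S] S by (intro subset_antisym) simp_all
  from gen_ge_dim[of S] this show False
    using S \<open>finite S\<close> \<open>card S < n\<close> by (simp add: dim_is_n)
qed

text \<open>Two adjacent corners suffice as candidates: the lowest one, and the one reached from it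
  along an axis \<open>i\<close> whose unit vector is outside the span.\<close>

lemma box_vec_notin_span:
  fixes lo hi :: "nat \<Rightarrow> real" and S :: "real vec set"
  assumes S: "S \<subseteq> carrier_vec n" "finite S" "card S < n"
    and lt: "\<And>i. i < n \<Longrightarrow> lo i < hi i"
  obtains w where "w \<in> carrier_vec n" "\<And>i. i < n \<Longrightarrow> lo i \<le> w $ i \<and> w $ i \<le> hi i"
    "w \<notin> LinearCombinations.module.span class_ring (module_vec TYPE(real) n) S"
proof -
  interpret vec_space "TYPE(real)" n .
  obtain i where i: "i < n" "unit_vec n i \<notin> span S"
    using unit_vec_notin_span[OF S] by blast
  let ?l = "vec n lo"
  let ?w = "?l + (hi i - lo i) \<cdot>\<^sub>v unit_vec n i"
  have "?l \<notin> span S \<or> ?w \<notin> span S"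
  proof (rule ccontr)
    assume "\<not> ?thesis"
    then have l: "?l \<in> span S" and w: "?w \<in> span S" by auto
    \<comment> \<open>The edge between the two corners lies in the span; dividing by its positive
      length puts the unit vector there too.\<close>
    have "(hi i - lo i) \<cdot>\<^sub>v unit_vec n i \<in> span S"
      using span_add[OF _ l, of "(hi i - lo i) \<cdot>\<^sub>v unit_vec n i"] S(1) w by simp
    from smult_in_span[OF S(1) this, of "1 / (hi i - lo i)"] show False
      using i lt[OF i(1)] by (simp add: smult_smult_assoc)
  qed
  then show thesis
    using that[of ?l] that[of ?w] lt i(1) by (force intro: less_imp_le)
qed

text \<open>Induction on the number \<open>m\<close> of added columns. As the bounds are functions
  and not matrices, the same \<open>lo\<close> and \<open>hi\<close> serve at every stage.\<close>

lemma full_column_rank_extend: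
  fixes lo hi :: "nat \<Rightarrow> nat \<Rightarrow> real"
  assumes X: "X \<in> carrier_mat n k" "full_column_rank X"
    and "k + m \<le> n"
    and lt: "\<And>i j. i < n \<Longrightarrow> j < m \<Longrightarrow> lo i j < hi i j"
  shows "\<exists>Y \<in> carrier_mat n m. (\<forall>i<n. \<forall>j<m. lo i j \<le> Y $$ (i, j) \<and> Y $$ (i, j) \<le> hi i j)
           \<and> full_column_rank (append_cols X Y)"
  using assms(3,4)
proof (induction m)
  case 0
  have "append_cols X (0\<^sub>m n 0) = X"
    using X(1) by (intro eq_matI) (auto simp: index_append_cols)
  then show ?case using X(2) by (intro bexI[of _ "0\<^sub>m n 0"]) auto
next
  case (Suc m)
  interpret vec_space "TYPE(real)" n .
  from Suc obtain Y where Y: "Y \<in> carrier_mat n m"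
    "\<And>i j. i < n \<Longrightarrow> j < m \<Longrightarrow> lo i j \<le> Y $$ (i, j) \<and> Y $$ (i, j) \<le> hi i j"
    "full_column_rank (append_cols X Y)" by force
  let ?S = "set (cols X) \<union> set (cols Y)"
  have S: "?S \<subseteq> carrier_vec n" "finite ?S"
    using X(1) Y(1) cols_dim[of X] cols_dim[of Y] by auto
  have dist: "distinct (cols X @ cols Y)" and li: "lin_indpt ?S"
    using Y(3) X(1) Y(1) unfolding full_column_rank_iff_lin_indpt
    by (auto simp: cols_append_cols)
  \<comment> \<open>Here \<open>k + Suc m \<le> n\<close> leaves room for one more independent
    vector, taken from the box that bounds column \<open>m\<close>.\<close>
  have "card ?S = k + m"
    using distinct_card[OF dist] X(1) Y(1) by simp
  then have "card ?S < n" using Suc.prems(1) by simp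
  then obtain w where w: "w \<in> carrier_vec n"
    "\<And>i. i < n \<Longrightarrow> lo i m \<le> w $ i \<and> w $ i \<le> hi i m" "w \<notin> span ?S"
    using box_vec_notin_span[OF S, of "\<lambda>i. lo i m" "\<lambda>i. hi i m"] Suc.prems(2) by blast
  \<comment> \<open>Besides independence, the columns must stay distinct when \<open>w\<close> joins
    them.\<close>
  have wS: "w \<notin> ?S" using w(3) span_mem[of ?S w] S(1) by auto
  have li': "lin_indpt (insert w ?S)"
    using lin_dep_iff_in_span[of ?S w] S(1) li w(1,3) wS by simp
  let ?Y = "append_cols Y (mat_of_cols n [w])"
  have "cols (append_cols X ?Y) = cols X @ cols Y @ [w]"
    using X(1) Y(1) w(1) by (simp add: cols_append_cols)
  then have "full_column_rank (append_cols X ?Y)"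
    using dist wS li' X(1) unfolding full_column_rank_iff_lin_indpt by auto
  moreover have "lo i j \<le> ?Y $$ (i, j) \<and> ?Y $$ (i, j) \<le> hi i j" if "i < n" "j < Suc m" for i j
    using that Y(1,2) w(2) by (auto simp: index_append_cols mat_of_cols_index less_Suc_eq)
  moreover have "?Y \<in> carrier_mat n (Suc m)" using Y(1) by auto
  ultimately show ?case by blast
qed

theorem theorem11:
  fixes n k :: nat and B C :: imat
  assumes "k \<le> n"
    and "B \<in> IR_mat n k"
    and "C \<in> IR_mat n (n - k)"
    and "\<forall>i < n. \<forall>j < n - k. 0 < radius_mat C $$ (i, j)"
  shows "AE_regular (append_cols_q (quantify Forall B) (quantify Exists C)) \<longleftrightarrow>
         strongly_full_column_rank B"
proof -
  have lt: "lower_mat C $$ (i, j) < upper_mat C $$ (i, j)" if "i < n" "j < n - k" for i j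
    using assms(4) that by (simp add: radius_mat_def IR_matD(1-4)[OF assms(3)])
  \<comment> \<open>The matrix is square because \<open>k \<le> n\<close> makes
    \<open>k + (n - k)\<close> equal to \<open>n\<close> in the natural numbers.\<close>
  have inv: "invertible_mat (append_cols X Y) \<longleftrightarrow> full_column_rank (append_cols X Y)"
    if "X \<in> carrier_mat n k" "Y \<in> carrier_mat n (n - k)" for X Y
    using that assms(1) by (intro invertible_mat_iff_full_column_rank[of _ n]) auto
  \<comment> \<open>Both sides of the theorem quantify universally over the members of
    \<open>B\<close>, so the equivalence can be shown for each \<open>X\<close> separately.\<close>
  have "(\<exists>Y \<in> members C. invertible_mat (append_cols X Y)) \<longleftrightarrow> full_column_rank X"
    if "X \<in> members B" for X
  proof -
    have X: "X \<in> carrier_mat n k" using that members_iff[OF assms(2)] by auto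
    show ?thesis
    proof
      assume "\<exists>Y \<in> members C. invertible_mat (append_cols X Y)"
      then obtain Y where "Y \<in> members C" and I: "invertible_mat (append_cols X Y)" by blast
      then have Y: "Y \<in> carrier_mat n (n - k)" using members_iff[OF assms(3)] by auto
      from full_column_rank_append_colsD[of X Y] show "full_column_rank X"
        using I inv[OF X Y] X Y by simp
    next
      assume "full_column_rank X"
      then obtain Y where Y: "Y \<in> carrier_mat n (n - k)" "full_column_rank (append_cols X Y)"
        "\<forall>i<n. \<forall>j<n - k. lower_mat C $$ (i, j) \<le> Y $$ (i, j) \<and> Y $$ (i, j) \<le> upper_mat C $$ (i, j)"
        using full_column_rank_extend[OF X, of "n - k" "\<lambda>i j. lower_mat C $$ (i, j)"
            "\<lambda>i j. upper_mat C $$ (i, j)"] lt assms(1) by auto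
      then show "\<exists>Y \<in> members C. invertible_mat (append_cols X Y)"
        using inv[OF X Y(1)] members_iff[OF assms(3)] by auto
    qed
  qed
  then show ?thesis
    unfolding AE_regular_append_iff[OF assms(2,3)] strongly_full_column_rank_def by blast
qed

end
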